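(* Let $r$ and $t$ be integers with $r-1\geq t>\frac{r}{4}$. Let $G$ be a multi $r$-edge-colored complete graph in which every edge has at least $t$ different colors. Then $V(G)$ can be covered by at most $r-t$ monochromatic components.
   Context: A complete graph $G$ is multi $r$-edge-colored if to each pair of distinct vertices $u,v$ a set $\emptyset\neq \mathrm{col}(uv)\subseteq [r]=\{1,\dots,r\}$ of colors is assigned, and the coloring is transitive: if $i\in \mathrm{col}(uv)\cap\mathrm{col}(vw)$ for distinct $u,v,w$, then $i\in\mathrm{col}(uw)$. The edge $uv$ has color $i$ if $i\in\mathrm{col}(uv)$. A monochromatic component of color $i$ is (the vertex set of) a connected component of the spanning subgraph of $G$ formed by the edges having color $i$. *)

theory Defs
  imports Complex_Main "Graph_Theory.Graph_Theory"
begin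

text \<open>
  The complete graph is given by its vertex set \<open>V\<close>, of arbitrary cardinality; the colour set
  of the edge \<open>uv\<close> is \<open>col {u, v}\<close>. The values of \<open>col\<close> on other sets play no role.
\<close>

definition multi_edge_colored :: "nat \<Rightarrow> 'a set \<Rightarrow> ('a set \<Rightarrow> nat set) \<Rightarrow> bool" where
  "multi_edge_colored r V col \<longleftrightarrow>
     (\<forall>u\<in>V. \<forall>v\<in>V. u \<noteq> v \<longrightarrow> col {u, v} \<noteq> {} \<and> col {u, v} \<subseteq> {1..r}) \<and>
     (\<forall>u\<in>V. \<forall>v\<in>V. \<forall>w\<in>V. u \<noteq> v \<and> v \<noteq> w \<and> u \<noteq> w \<longrightarrow>
        col {u, v} \<inter> col {v, w} \<subseteq> col {u, w})"

definition color_graph :: "'a set \<Rightarrow> ('a set \<Rightarrow> nat set) \<Rightarrow> nat \<Rightarrow> 'a pair_pre_digraph" where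
  "color_graph V col i =
     \<lparr> pverts = V, parcs = {(u, v). u \<in> V \<and> v \<in> V \<and> u \<noteq> v \<and> i \<in> col {u, v}} \<rparr>"

text \<open>
  Undirected graphs are symmetric digraphs, so the vertex sets of the connected components are
  those of the strongly connected components. A vertex without an edge of colour \<open>i\<close> forms a
  component of colour \<open>i\<close> by itself.
\<close>

definition mono_components :: "'a set \<Rightarrow> ('a set \<Rightarrow> nat set) \<Rightarrow> nat \<Rightarrow> 'a set set" where
  "mono_components V col i = pre_digraph.sccs_verts (with_proj (color_graph V col i))"

end

theory Submission
  imports Defs
begin

text \<open>
  Call the colours \<open>i\<close> for which \<open>u\<close> and \<open>v\<close> lie in a common component of colour \<open>i\<close> the agreement
  set of \<open>u\<close> and \<open>v\<close>, and suppose that no \<open>r - t\<close> components cover. Choosing the components of one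
  vertex \<open>u\<close> in all colours outside a \<open>t\<close>-set \<open>T\<close> leaves a vertex whose agreement set with \<open>u\<close> is
  exactly \<open>T\<close>. If \<open>u\<close>, \<open>v\<close> have agreement set \<open>T\<close>, take the components of \<open>T\<close> together with those
  of both \<open>u\<close> and \<open>v\<close> in about \<open>(r - t - |T|) / 2\<close> further colours: an uncovered vertex has disjoint
  agreement sets with \<open>u\<close> and \<open>v\<close> in what remains, and there is no room for two \<open>t\<close>-sets unless
  \<open>|T| \<le> r - 3t + 1\<close> or \<open>|T| = r\<close>. Hence \<open>r = 4t - 1\<close> and all agreement sets have size \<open>t\<close> or \<open>r\<close>.
  Finally choose \<open>u\<close>, \<open>v\<close>, \<open>w\<close> with agreement sets \<open>S \<union> {a}\<close>, \<open>S \<union> {b}\<close> and \<open>S \<union> {c}\<close>, where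
  \<open>|S| = t - 1\<close>. For \<open>t \<ge> 2\<close> the components of \<open>S\<close> and those of all three vertices in the colours
  \<open>a\<close> and \<open>b\<close> leave only \<open>3t - 1 < 3t\<close> agreements for an uncovered vertex; for \<open>t = 1\<close> the two
  components in colour \<open>a\<close> suffice.
\<close>

text \<open>A hypothetical counterexample in terms of agreement sets. A pair \<open>(i, u)\<close>
  in \<open>P\<close> stands for the component of colour \<open>i\<close> containing
  \<open>u\<close>, so \<open>uncovered\<close> says that no \<open>r - t\<close> components
  cover.\<close>

locale uncoverable =
  fixes r t :: nat and V :: "'a set" and ag :: "'a \<Rightarrow> 'a \<Rightarrow> nat set"
  assumes t_pos: "0 < t" and t_less: "t < r" and r_less: "r < 4 * t"
    and nonempty: "V \<noteq> {}"
    and ag_subset: "u \<in> V \<Longrightarrow> v \<in> V \<Longrightarrow> ag u v \<subseteq> {1..r}"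
    and ag_sym: "ag u v = ag v u"
    and ag_trans: "u \<in> V \<Longrightarrow> v \<in> V \<Longrightarrow> w \<in> V \<Longrightarrow> ag u v \<inter> ag v w \<subseteq> ag u w"
    and card_ag: "u \<in> V \<Longrightarrow> v \<in> V \<Longrightarrow> t \<le> card (ag u v)"
    and uncovered: "P \<subseteq> {1..r} \<times> V \<Longrightarrow> finite P \<Longrightarrow> card P \<le> r - t \<Longrightarrow> \<exists>y\<in>V. \<forall>(i, u)\<in>P. i \<notin> ag u y"
begin

lemma finite_ag: "u \<in> V \<Longrightarrow> v \<in> V \<Longrightarrow> finite (ag u v)"
  using ag_subset finite_subset by blast

lemma exists_ag_eq:
  assumes "u \<in> V" "T \<subseteq> {1..r}" "card T = t"
  shows "\<exists>v\<in>V. ag u v = T"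
proof -
  have "finite T" using assms(2) finite_subset by blast
  then have "card (({1..r} - T) \<times> {u}) \<le> r - t"
    using assms by (simp add: card_cartesian_product card_Diff_subset)
  moreover have "({1..r} - T) \<times> {u} \<subseteq> {1..r} \<times> V" "finite (({1..r} - T) \<times> {u})"
    using assms(1) by auto
  ultimately have "\<exists>v\<in>V. \<forall>(i, x)\<in>({1..r} - T) \<times> {u}. i \<notin> ag x v" by (intro uncovered)
  then obtain v where v: "v \<in> V" "\<And>i. i \<in> {1..r} - T \<Longrightarrow> i \<notin> ag u v" by blast
  have "ag u v \<subseteq> T" using ag_subset[OF assms(1) v(1)] v(2) by blast
  then have "ag u v = T"
    using card_ag[OF assms(1) v(1)] assms(3) \<open>finite T\<close> by (simp add: card_seteq)
  then show ?thesis using v(1) by blast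
qed

section \<open>Sizes of agreement sets\<close>

text \<open>Counts the agreements with \<open>u\<close> and \<open>v\<close> of a vertex missed by the components of \<open>u\<close> in the
  colours \<open>K\<close> and by those of both \<open>u\<close> and \<open>v\<close> in the colours \<open>Y\<close>.\<close>

lemma two_vertex_bound:
  assumes u: "u \<in> V" and v: "v \<in> V" and K: "K \<subseteq> ag u v" and Y: "Y \<subseteq> {1..r} - ag u v"
    and card_le: "card K + 2 * card Y \<le> r - t"
  shows "2 * t + 2 * card K + card Y \<le> r + card (ag u v)"
proof -
  let ?T = "ag u v" and ?P = "K \<times> {u} \<union> Y \<times> {u, v}"
  have T: "?T \<subseteq> {1..r}" "finite ?T" using ag_subset finite_ag u v by auto
  have fin: "finite K" "finite Y" using K T(2) Y finite_subset by blast+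
  have "card ?P \<le> card (K \<times> {u}) + card (Y \<times> {u, v})" by (rule card_Un_le)
  also have "\<dots> \<le> card K + card Y * 2"
    by (auto simp: card_cartesian_product card_insert_if)
  finally have "card ?P \<le> r - t" using card_le by linarith
  moreover have "?P \<subseteq> {1..r} \<times> V" using K Y T u v by auto
  moreover have "finite ?P" using fin by simp
  ultimately have "\<exists>y\<in>V. \<forall>(i, x)\<in>?P. i \<notin> ag x y" by (intro uncovered)
  then obtain y where y: "y \<in> V" "\<forall>(i, x)\<in>?P. i \<notin> ag x y" by blast
  have "ag u y \<inter> K = {}" "ag u y \<inter> Y = {}" "ag v y \<inter> Y = {}" using y(2) by auto
  \<comment> \<open>In the colours of \<open>K\<close> the components of \<open>u\<close> and
    \<open>v\<close> coincide.\<close>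
  moreover have "ag v y \<inter> K = {}"
    using ag_trans[OF u v y(1)] K \<open>ag u y \<inter> K = {}\<close> by auto
  ultimately have "ag u y \<union> ag v y \<subseteq> {1..r} - (K \<union> Y)"
    using ag_subset[OF u y(1)] ag_subset[OF v y(1)] by auto
  then have un: "card (ag u y \<union> ag v y) \<le> card ({1..r} - (K \<union> Y))"
    by (intro card_mono) auto
  have KY: "card (K \<union> Y) = card K + card Y" "K \<union> Y \<subseteq> {1..r}"
    using fin K Y T by (auto intro!: card_Un_disjoint)
  then have KYr: "card K + card Y \<le> r" using card_mono[OF _ KY(2)] by simp
  have un': "card (ag u y \<union> ag v y) \<le> r - (card K + card Y)"
    using un KY fin by (simp add: card_Diff_subset)
  have "ag u y \<inter> ag v y \<subseteq> ?T - K"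
    using ag_trans[OF u y(1) v] \<open>ag u y \<inter> K = {}\<close> by (auto simp: ag_sym[of y v])
  then have "card (ag u y \<inter> ag v y) \<le> card (?T - K)"
    using T by (intro card_mono) auto
  then have int: "card (ag u y \<inter> ag v y) \<le> card ?T - card K"
    using fin K by (simp add: card_Diff_subset)
  have "card K \<le> card ?T" using K T by (simp add: card_mono)
  moreover have "card (ag u y) + card (ag v y) = card (ag u y \<union> ag v y) + card (ag u y \<inter> ag v y)"
    using u v y(1) by (intro card_Un_Int finite_ag)
  moreover have "t \<le> card (ag u y)" "t \<le> card (ag v y)" using card_ag u v y(1) by auto
  ultimately show ?thesis using un' int KYr by linarith
qed

lemma card_ag_cases:
  assumes u: "u \<in> V" and v: "v \<in> V"
  shows "card (ag u v) + 3 * t \<le> r + 1 \<or> card (ag u v) = r"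
proof (rule ccontr)
  assume neg: "\<not> ?thesis"
  define s where "s = card (ag u v)"
  have T: "ag u v \<subseteq> {1..r}" "finite (ag u v)" using ag_subset finite_ag u v by auto
  have "s \<le> r" using card_mono[OF _ T(1)] by (simp add: s_def)
  with neg have s: "s < r" "s + 3 * t \<ge> r + 2" by (auto simp: s_def)
  show False
  proof (cases "s \<le> r - t")
    case True
    \<comment> \<open>With all of \<open>ag u v\<close> as \<open>K\<close>, this is the largest
      size of \<open>Y\<close> within the budget; rounding down costs the 1 in
      \<open>r + 1\<close>.\<close>
    define m where "m = (r - t - s) div 2"
    have "card ({1..r} - ag u v) = r - s" using T by (simp add: card_Diff_subset s_def)
    then obtain Y where Y: "Y \<subseteq> {1..r} - ag u v" "card Y = m"
      by (metis obtain_subset_with_card_n diff_commute diff_le_self div_le_dividend le_trans m_def)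
    have "s + 2 * m \<le> r - t" using True by (auto simp: m_def)
    then have "2 * t + 2 * s + m \<le> r + s"
      using two_vertex_bound[OF u v order_refl Y(1)] Y(2) by (simp add: s_def)
    then show False using s t_less r_less True unfolding m_def by linarith
  next
    case False
    then obtain K where K: "K \<subseteq> ag u v" "card K = r - t"
      by (metis obtain_subset_with_card_n nat_le_linear s_def)
    then have "2 * t + 2 * (r - t) \<le> r + s"
      using two_vertex_bound[OF u v K(1), of "{}"] by (simp add: s_def)
    then show False using s t_less by linarith
  qed
qed

text \<open>Some agreement set has size \<open>t\<close>, so \<open>card_ag_cases\<close> gives
  \<open>4 * t \<le> r + 1\<close>; \<open>r_less\<close> gives the converse.\<close>

lemma r_eq: "r + 1 = 4 * t"
proof -
  obtain u where u: "u \<in> V" using nonempty by auto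
  have "{1..t} \<subseteq> {1..r}" "card {1..t} = t" using t_less by auto
  from exists_ag_eq[OF u this] obtain v where "v \<in> V" "ag u v = {1..t}" by blast
  then show ?thesis using card_ag_cases[OF u, of v] t_less r_less by auto
qed

text \<open>For \<open>r = 4 * t - 1\<close> the first case of \<open>card_ag_cases\<close> bounds
  the size by \<open>t\<close>, and the missing colour \<open>i\<close> excludes the second.\<close>

lemma card_ag_eq:
  assumes "u \<in> V" "v \<in> V" "i \<in> {1..r}" "i \<notin> ag u v"
  shows "card (ag u v) = t"
proof -
  have "ag u v \<subset> {1..r}" using ag_subset assms by auto
  then have "card (ag u v) < r" using psubset_card_mono[of "{1..r}"] by simp
  then show ?thesis using card_ag_cases[OF assms(1,2)] card_ag[OF assms(1,2)] r_eq by linarith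
qed

section \<open>Three vertices in the extremal case\<close>

lemma t_eq_1: "t = 1"
proof (rule ccontr)
  assume "t \<noteq> 1"
  then have t2: "t \<ge> 2" using t_pos by linarith
  define S where "S = {1..t - 1}"
  obtain u where u: "u \<in> V" using nonempty by auto
  have S: "finite S" "card S = t - 1" "t \<notin> S" "Suc t \<notin> S" "S \<subseteq> {1..r}"
    using t2 t_less by (auto simp: S_def)
  have ab: "t \<in> {1..r}" "Suc t \<in> {1..r}" using t2 t_less by auto
  obtain v where v: "v \<in> V" "ag u v = insert t S"
    using exists_ag_eq[OF u, of "insert t S"] S ab t2 by auto
  obtain w where w: "w \<in> V" "ag u w = insert (Suc t) S"
    using exists_ag_eq[OF u, of "insert (Suc t) S"] S ab t2 by auto
  have a: "t \<notin> ag v w" using ag_trans[OF u v(1) w(1)] v(2) w(2) S by auto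
  have "Suc t \<notin> ag w v" using ag_trans[OF u w(1) v(1)] v(2) w(2) S by auto
  then have b: "Suc t \<notin> ag v w" by (simp add: ag_sym)
  have Svw: "S \<subseteq> ag v w" using ag_trans[OF v(1) u w(1)] v(2) w(2) by (auto simp: ag_sym[of v u])
  have "card (ag v w - S) = t - (t - 1)"
    using card_ag_eq[OF v(1) w(1) ab(1) a] Svw S by (simp add: card_Diff_subset)
  then have vw1: "card (ag v w - S) = 1" using t2 by simp
  \<comment> \<open>Two pairs per colour account for all three vertices: \<open>u\<close> and
    \<open>v\<close> share their component in colour \<open>t\<close>, and \<open>u\<close> and
    \<open>w\<close> theirs in colour \<open>Suc t\<close>.\<close>
  let ?P = "S \<times> {u} \<union> {(t, u), (t, w), (Suc t, u), (Suc t, v)}"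
  have "card {(t, u), (t, w), (Suc t, u), (Suc t, v)} \<le> 4"
    by (simp add: card_insert_if)
  then have "card ?P \<le> t - 1 + 4"
    using card_Un_le[of "S \<times> {u}" "{(t, u), (t, w), (Suc t, u), (Suc t, v)}"] S
    by (simp add: card_cartesian_product)
  \<comment> \<open>Since \<open>r - t = 3 * t - 1\<close>, the \<open>t + 3\<close> components fit
    because \<open>t \<ge> 2\<close>.\<close>
  then have "card ?P \<le> r - t" using r_eq t2 by linarith
  moreover have "?P \<subseteq> {1..r} \<times> V" using S ab u v(1) w(1) by auto
  moreover have "finite ?P" using S by simp
  ultimately have "\<exists>y\<in>V. \<forall>(i, x)\<in>?P. i \<notin> ag x y" by (intro uncovered)
  then obtain y where y: "y \<in> V" "\<And>i. i \<in> S \<Longrightarrow> i \<notin> ag u y"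
    "t \<notin> ag u y" "t \<notin> ag w y" "Suc t \<notin> ag u y" "Suc t \<notin> ag v y"
    by auto
  define M where "M = {1..r} - insert t (insert (Suc t) S)"
  have M: "finite M" "card M = r - (t + 1)"
    using S ab t2 by (auto simp: M_def card_Diff_subset)
  have yu: "ag u y \<subseteq> M" using y(2-) ag_subset[OF u y(1)] by (auto simp: M_def)
  have yv: "ag v y \<subseteq> M"
    using y(6) yu ag_subset[OF v(1) y(1)] ag_trans[OF u v(1) y(1)] v(2) by (auto simp: M_def)
  have yw: "ag w y \<subseteq> M"
    using y(4) yu ag_subset[OF w(1) y(1)] ag_trans[OF u w(1) y(1)] w(2) by (auto simp: M_def)
  have "ag u y \<inter> ag v y \<subseteq> ag u v" "ag u y \<inter> ag w y \<subseteq> ag u w" "ag v y \<inter> ag w y \<subseteq> ag v w"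
    using ag_trans[OF u y(1) v(1)] ag_trans[OF u y(1) w(1)] ag_trans[OF v(1) y(1) w(1)]
    by (auto simp: ag_sym[of y])
  then have "ag u y \<inter> ag v y = {}" "ag u y \<inter> ag w y = {}" and vw: "ag v y \<inter> ag w y \<subseteq> ag v w - S"
    using yu yv v(2) w(2) by (auto simp: M_def)
  then have disj: "ag u y \<inter> (ag v y \<union> ag w y) = {}" by auto
  have fin: "finite (ag u y)" "finite (ag v y)" "finite (ag w y)" "finite (ag v w)"
    using finite_ag u v(1) w(1) y(1) by auto
  have "card (ag v y \<inter> ag w y) \<le> 1" using card_mono[OF _ vw] fin vw1 by simp
  moreover have "card (ag v y) + card (ag w y) = card (ag v y \<union> ag w y) + card (ag v y \<inter> ag w y)"
    using fin by (intro card_Un_Int)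
  moreover have "card (ag u y) + card (ag v y \<union> ag w y) = card (ag u y \<union> (ag v y \<union> ag w y))"
    using fin disj by (simp add: card_Un_disjoint)
  moreover have "card (ag u y \<union> (ag v y \<union> ag w y)) \<le> card M"
    using yu yv yw M by (intro card_mono) auto
  moreover have "t \<le> card (ag u y)" "t \<le> card (ag v y)" "t \<le> card (ag w y)"
    using card_ag u v(1) w(1) y(1) by auto
  \<comment> \<open>Only the sets of \<open>v\<close> and \<open>w\<close> can overlap, in at most
    one colour, whence \<open>3 * t \<le> card M + 1 = 3 * t - 1\<close>.\<close>
  ultimately show False using M r_eq t2 by linarith
qed

lemma contradiction: False
proof -
  have r3: "r = 3" using r_eq t_eq_1 by simp
  have col: "{1..r} = {1, 2, 3}" using r3 by auto
  obtain u where u: "u \<in> V" using nonempty by auto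
  obtain v where v: "v \<in> V" "ag u v = {1}"
    using exists_ag_eq[OF u, of "{1}"] t_eq_1 r3 by auto
  obtain w where w: "w \<in> V" "ag u w = {2}"
    using exists_ag_eq[OF u, of "{2}"] t_eq_1 r3 by auto
  have "1 \<notin> ag v w" using ag_trans[OF u v(1) w(1)] v(2) w(2) by auto
  moreover have "2 \<notin> ag w v" using ag_trans[OF u w(1) v(1)] v(2) w(2) by auto
  ultimately have "ag v w \<subseteq> {3}" using ag_subset[OF v(1) w(1)] col by (auto simp: ag_sym[of w])
  moreover have "ag v w \<noteq> {}" using card_ag[OF v(1) w(1)] t_eq_1 by auto
  ultimately have vw: "ag v w = {3}" by auto
  have "card {(1::nat, u), (1, w)} \<le> r - t" using r3 t_eq_1 by (simp add: card_insert_if)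
  then obtain y where y: "y \<in> V" "1 \<notin> ag u y" "1 \<notin> ag w y"
    using uncovered[of "{(1, u), (1, w)}"] u w(1) r3 by auto
  have yv: "1 \<notin> ag v y" using ag_trans[OF u v(1) y(1)] v(2) y(2) by auto
  have one: "card (ag x y) = 1" if "x \<in> V" "1 \<notin> ag x y" for x
    using card_ag_eq[OF that(1) y(1), of 1] that(2) t_eq_1 r3 by auto
  have cases: "ag x y = {2} \<or> ag x y = {3}" if "x \<in> V" "1 \<notin> ag x y" for x
  proof -
    from one[OF that] obtain i where i: "ag x y = {i}" by (rule card_1_singletonE)
    have "ag x y \<subseteq> {1, 2, 3}" using ag_subset[OF that(1) y(1)] unfolding col .
    then show ?thesis using i that(2) by auto
  qed
  have "ag u y \<inter> ag v y \<subseteq> {1}" "ag u y \<inter> ag w y \<subseteq> {2}" "ag v y \<inter> ag w y \<subseteq> {3}"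
    using ag_trans[OF u y(1) v(1)] ag_trans[OF u y(1) w(1)] ag_trans[OF v(1) y(1) w(1)]
    unfolding v(2) w(2) vw by (auto simp: ag_sym[of y])
  moreover have "{2} \<inter> ag u y \<subseteq> ag w y" "{3} \<inter> ag v y \<subseteq> ag w y"
    using ag_trans[OF w(1) u y(1)] ag_trans[OF w(1) v(1) y(1)]
    unfolding ag_sym[of w u] ag_sym[of w v] w(2) vw by auto
  \<comment> \<open>The sets of \<open>u\<close> and \<open>v\<close> are \<open>{2}\<close> and
    \<open>{3}\<close> in some order. If \<open>ag u y = {2}\<close>, then \<open>ag w y\<close>
    contains both 2 and 3; if \<open>ag u y = {3}\<close>, it contains neither.\<close>
  ultimately show False
    using cases[OF u y(2)] cases[OF v(1) yv] cases[OF w(1) y(3)] by auto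
qed

end

section \<open>From monochromatic components to agreement sets\<close>

lemma wf_color_graph: "wf_digraph (with_proj (color_graph V col i))"
  by (unfold_locales) (auto simp: color_graph_def)

text \<open>Edges of a colour run in both directions, so \<open>scc_of u\<close> contains every
  neighbour of \<open>u\<close> in that colour.\<close>

lemma exists_mono_component:
  assumes "u \<in> V"
  shows "\<exists>C\<in>mono_components V col i. \<forall>y\<in>V. y = u \<or> i \<in> col {u, y} \<longrightarrow> y \<in> C"
proof -
  let ?G = "with_proj (color_graph V col i)"
  interpret wf_digraph ?G by (rule wf_color_graph)
  have u: "u \<in> verts ?G" using assms by (simp add: color_graph_def)
  have "y \<in> scc_of u" if "y \<in> V" "y = u \<or> i \<in> col {u, y}" for y
  proof (cases "y = u")
    case True
    then show ?thesis using in_scc_of_self[OF u] by simp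
  next
    case False
    then have "u \<rightarrow>\<^bsub>?G\<^esub> y" "y \<rightarrow>\<^bsub>?G\<^esub> u"
      using that assms by (auto simp: color_graph_def insert_commute)
    then show ?thesis by (auto simp: scc_of_def)
  qed
  then show ?thesis
    using scc_of_in_sccs_verts[OF u] unfolding mono_components_def by blast
qed

theorem theorem3:
  fixes r t :: nat and V :: "'a set" and col :: "'a set \<Rightarrow> nat set"
  assumes "real r - 1 \<ge> real t" and "real t > real r / 4"
    and "multi_edge_colored r V col"
    and "\<And>u v. u \<in> V \<Longrightarrow> v \<in> V \<Longrightarrow> u \<noteq> v \<Longrightarrow> card (col {u, v}) \<ge> t"
  shows "\<exists>F. F \<subseteq> (\<Union>i\<in>{1..r}. mono_components V col i) \<and>
             finite F \<and> card F \<le> r - t \<and> V \<subseteq> \<Union> F"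
proof (rule ccontr)
  assume no: "\<not> ?thesis"
  \<comment> \<open>A vertex shares its own component in every colour, whatever value
    \<open>col {u}\<close> has; this keeps transitivity valid for coinciding vertices.\<close>
  define ag where "ag u v = (if u = v then {1..r} else col {u, v})" for u v
  have "\<forall>p. \<exists>C. snd p \<in> V \<longrightarrow> C \<in> mono_components V col (fst p) \<and>
          (\<forall>y\<in>V. y = snd p \<or> fst p \<in> col {snd p, y} \<longrightarrow> y \<in> C)"
    using exists_mono_component[of _ V col] by blast
  from choice[OF this] obtain C where C: "\<And>i u. u \<in> V \<Longrightarrow> C (i, u) \<in> mono_components V col i"
    "\<And>i u y. u \<in> V \<Longrightarrow> y \<in> V \<Longrightarrow> y = u \<or> i \<in> col {u, y} \<Longrightarrow> y \<in> C (i, u)"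
    by (metis fst_conv snd_conv)
  have sub: "col {u, v} \<subseteq> {1..r}" if "u \<in> V" "v \<in> V" "u \<noteq> v" for u v
    using assms(3) that unfolding multi_edge_colored_def by blast
  have tr: "col {u, v} \<inter> col {v, w} \<subseteq> col {u, w}"
    if "u \<in> V" "v \<in> V" "w \<in> V" "u \<noteq> v" "v \<noteq> w" "u \<noteq> w" for u v w
    using assms(3) that unfolding multi_edge_colored_def by blast
  interpret uncoverable r t V ag
  proof
    show "0 < t" "t < r" "r < 4 * t" using assms(1,2) by linarith+
    show "V \<noteq> {}" using no by (auto dest: spec[of _ "{}"])
    show "ag u v \<subseteq> {1..r}" if "u \<in> V" "v \<in> V" for u v
      using sub[OF that] by (simp add: ag_def)
    show "ag u v = ag v u" for u v by (simp add: ag_def insert_commute)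
    show "ag u v \<inter> ag v w \<subseteq> ag u w" if "u \<in> V" "v \<in> V" "w \<in> V" for u v w
      using tr[OF that] sub[of u v] that by (auto simp: ag_def)
    show "t \<le> card (ag u v)" if "u \<in> V" "v \<in> V" for u v
      using assms(1) assms(4)[OF that] by (simp add: ag_def)
    \<comment> \<open>If \<open>P\<close> missed no vertex, its image under \<open>C\<close> would
      be a cover by at most \<open>r - t\<close> components.\<close>
    show "\<exists>y\<in>V. \<forall>(i, u)\<in>P. i \<notin> ag u y" if P: "P \<subseteq> {1..r} \<times> V" "finite P" "card P \<le> r - t" for P
    proof (rule ccontr)
      assume "\<not> ?thesis"
      then have cov: "\<exists>(i, u)\<in>P. i \<in> ag u y" if "y \<in> V" for y using that by blast
      let ?F = "C ` P"
      have "V \<subseteq> \<Union> ?F"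
      proof
        fix y assume y: "y \<in> V"
        then obtain i u where iu: "(i, u) \<in> P" "i \<in> ag u y" using cov by blast
        then have "y \<in> C (i, u)" using C(2)[of u y i] P(1) y by (auto simp: ag_def split: if_splits)
        then show "y \<in> \<Union> ?F" using iu(1) by force
      qed
      moreover have "?F \<subseteq> (\<Union>i\<in>{1..r}. mono_components V col i)" using P(1) C(1) by fastforce
      ultimately show False
        using no P(2,3) card_image_le[of P C] by (meson finite_imageI le_trans)
    qed
  qed
  show False by (rule contradiction)
qed

end
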